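(* Let $V$ be a finite-dimensional complex $S_d$-module, and equip $\bigoplus_{\underline{d}}(V^{S_{\underline{d}}})^*$ with the $\mathrm{GL}(\mathbb{E})$-action obtained by applying the Schur--Weyl construction to $V^*$, via the identifications described in the context. Let $a\in[n-1]$ and $\underline{d}=(d_1,\dots,d_n)\in\mathcal{P}^{++}_{n,d}$. If $d_{a+1}\ge1$, then $E_a:(V^{S_{\underline{d}}})^*\to(V^{S_{\tilde e_a\underline{d}}})^*$ is the adjoint of the map $$\tfrac{d_{a+1}}{d_a+1}F_a:V^{S_{\tilde e_a\underline{d}}}\to V^{S_{\underline{d}}}.$$ If $d_a\ge1$, then $F_a:(V^{S_{\underline{d}}})^*\to(V^{S_{\tilde f_a\underline{d}}})^*$ is the adjoint of the map $$\tfrac{d_a}{d_{a+1}+1}E_a:V^{S_{\tilde f_a\underline{d}}}\to V^{S_{\underline{d}}}.$$ Here $E_a,F_a$ on the right are the Chevalley generators for $V$.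
   Context: Fix $n,d\ge1$. Let $\mathcal{P}_{n,d}$ be the set of compositions $\underline{d}=(d_1,\dots,d_n)$ of $d$ with $d_i\ge0$, and let $\mathcal{P}^{++}_{n,d}$ be those with $d_1\ge\dots\ge d_n$. Let $S_{\underline{d}}=S_{d_1}\times\dots\times S_{d_n}\subseteq S_d$ be the block subgroup. The composition $\tilde e_a\underline{d}$ replaces $(d_a,d_{a+1})$ by $(d_a+1,d_{a+1}-1)$, and $\tilde f_a\underline{d}$ replaces them by $(d_a-1,d_{a+1}+1)$. Let $\mathbb{E}=\mathbb{C}^n$ with basis $\theta_i$ and $\theta_{\underline{d}}=\theta_1^{\otimes d_1}\otimes\dots\otimes\theta_n^{\otimes d_n}$. For any $S_d$-module $M$, transport the $\mathrm{GL}(\mathbb{E})$-action on $(M\otimes\mathbb{E}^{\otimes d})^{S_d}$ to $\bigoplus_{\underline{d}}M^{S_{\underline{d}}}$ via $m\mapsto\frac{1}{\#S_d}\sum_{x\in S_d}x(m)\otimes x(\theta_{\underline{d}})$ on $M^{S_{\underline{d}}}$. The Chevalley generators are $E_a\theta_{a+1}=\theta_a$, $F_a\theta_a=\theta_{a+1}$, and both kill the other basis vectors. For $M=V$ this gives operators $E_a:V^{S_{\underline{d}}}\to V^{S_{\tilde e_a\underline{d}}}$ and $F_a:V^{S_{\underline{d}}}\to V^{S_{\tilde f_a\underline{d}}}$. Applying this construction to $M=V^*$, the invariants $(V^* )^{S_{\underline{d}}}$ are identified with $(V_{S_{\underline{d}}})^*$, the dual of the coinvariants. This is further identified with $(V^{S_{\underline{d}}})^*$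 using the isomorphism $V_{S_{\underline{d}}}\to V^{S_{\underline{d}}}$, $[v]\mapsto\frac{1}{\#S_{\underline{d}}}\sum_{g\in S_{\underline{d}}}gv$. *)

theory Defs
  imports "HOL-Analysis.Analysis" "HOL-Library.Function_Algebras"
begin

text \<open>Conventions. Positions of tensor factors are 1..d, letters (basis vectors theta_i of E)
are 1..n. A composition dd is a function nat => nat read on 1..n. A basis tensor
theta_{w 1} (x) ... (x) theta_{w d} of E^{(x) d} is encoded by a word w : nat => nat with values
in 1..n on 1..d and 0 elsewhere; an element of M (x) E^{(x) d} is a function from words to M.\<close>

definition Sd :: "nat \<Rightarrow> (nat \<Rightarrow> nat) set" where
  "Sd d = {x. x permutes {1..d}}"

text \<open>The word of theta_dd = theta_1^{d_1} (x) ... (x) theta_n^{d_n}.\<close>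
definition wordof :: "nat \<Rightarrow> (nat \<Rightarrow> nat) \<Rightarrow> nat \<Rightarrow> nat" where
  "wordof d dd i = (if i \<in> {1..d} then (LEAST j. i \<le> (\<Sum>k=1..j. dd k)) else 0)"

text \<open>Block (Young) subgroup S_dd: permutations preserving the blocks of dd.\<close>
definition block :: "nat \<Rightarrow> (nat \<Rightarrow> nat) \<Rightarrow> (nat \<Rightarrow> nat) set" where
  "block d dd = {x \<in> Sd d. wordof d dd \<circ> x = wordof d dd}"

definition words :: "nat \<Rightarrow> nat \<Rightarrow> (nat \<Rightarrow> nat) set" where
  "words n d = {u. (\<forall>i\<in>{1..d}. u i \<in> {1..n}) \<and> (\<forall>i. i \<notin> {1..d} \<longrightarrow> u i = 0)}"

definition invariants :: "((nat \<Rightarrow> nat) \<Rightarrow> 'm \<Rightarrow> 'm) \<Rightarrow> (nat \<Rightarrow> nat) set \<Rightarrow> 'm set" where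
  "invariants \<rho> H = {m. \<forall>h\<in>H. \<rho> h m = m}"

definition e_comp :: "nat \<Rightarrow> (nat \<Rightarrow> nat) \<Rightarrow> nat \<Rightarrow> nat" where
  "e_comp a dd = dd(a := dd a + 1, Suc a := dd (Suc a) - 1)"

definition f_comp :: "nat \<Rightarrow> (nat \<Rightarrow> nat) \<Rightarrow> nat \<Rightarrow> nat" where
  "f_comp a dd = dd(a := dd a - 1, Suc a := dd (Suc a) + 1)"

text \<open>The embedding M^{S_dd} -> (M (x) E^{(x) d})^{S_d},
  m |-> 1/d! * sum_x x(m) (x) x(theta_dd), where x acts on words by w |-> w o x^{-1}.\<close>
definition SW_embed :: "(complex \<Rightarrow> 'm \<Rightarrow> 'm) \<Rightarrow> ((nat \<Rightarrow> nat) \<Rightarrow> 'm \<Rightarrow> 'm) \<Rightarrow> nat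
    \<Rightarrow> (nat \<Rightarrow> nat) \<Rightarrow> 'm \<Rightarrow> (nat \<Rightarrow> nat) \<Rightarrow> 'm::comm_monoid_add" where
  "SW_embed sc \<rho> d dd m = (\<lambda>u. sc (inverse (fact d))
      (\<Sum>x\<in>{x\<in>Sd d. wordof d dd \<circ> inv x = u}. \<rho> x m))"

text \<open>Action of the Chevalley generators E_a (theta_{a+1} |-> theta_a) and
  F_a (theta_a |-> theta_{a+1}) on M (x) E^{(x) d} (acting on the tensor factors as a derivation).\<close>
definition tensE :: "nat \<Rightarrow> nat \<Rightarrow> ((nat \<Rightarrow> nat) \<Rightarrow> 'm) \<Rightarrow> (nat \<Rightarrow> nat) \<Rightarrow> 'm::comm_monoid_add" where
  "tensE d a T u = (\<Sum>i\<in>{i\<in>{1..d}. u i = a}. T (u(i := Suc a)))"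

definition tensF :: "nat \<Rightarrow> nat \<Rightarrow> ((nat \<Rightarrow> nat) \<Rightarrow> 'm) \<Rightarrow> (nat \<Rightarrow> nat) \<Rightarrow> 'm::comm_monoid_add" where
  "tensF d a T u = (\<Sum>i\<in>{i\<in>{1..d}. u i = Suc a}. T (u(i := a)))"

text \<open>Transported operators E_a : M^{S_dd} -> M^{S_{e_a dd}} and F_a : M^{S_dd} -> M^{S_{f_a dd}}.\<close>
definition SW_E :: "(complex \<Rightarrow> 'm \<Rightarrow> 'm) \<Rightarrow> ((nat \<Rightarrow> nat) \<Rightarrow> 'm \<Rightarrow> 'm) \<Rightarrow> nat \<Rightarrow> nat \<Rightarrow> nat
    \<Rightarrow> (nat \<Rightarrow> nat) \<Rightarrow> 'm \<Rightarrow> 'm::comm_monoid_add" where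
  "SW_E sc \<rho> n d a dd m = (THE m'. m' \<in> invariants \<rho> (block d (e_comp a dd)) \<and>
     (\<forall>u\<in>words n d. SW_embed sc \<rho> d (e_comp a dd) m' u = tensE d a (SW_embed sc \<rho> d dd m) u))"

definition SW_F :: "(complex \<Rightarrow> 'm \<Rightarrow> 'm) \<Rightarrow> ((nat \<Rightarrow> nat) \<Rightarrow> 'm \<Rightarrow> 'm) \<Rightarrow> nat \<Rightarrow> nat \<Rightarrow> nat
    \<Rightarrow> (nat \<Rightarrow> nat) \<Rightarrow> 'm \<Rightarrow> 'm::comm_monoid_add" where
  "SW_F sc \<rho> n d a dd m = (THE m'. m' \<in> invariants \<rho> (block d (f_comp a dd)) \<and>
     (\<forall>u\<in>words n d. SW_embed sc \<rho> d (f_comp a dd) m' u = tensF d a (SW_embed sc \<rho> d dd m) u))"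

text \<open>Dual module V^*: (x f)(v) = f(x^{-1} v), scalars act pointwise.\<close>
definition dual_act :: "((nat \<Rightarrow> nat) \<Rightarrow> 'v \<Rightarrow> 'v) \<Rightarrow> (nat \<Rightarrow> nat) \<Rightarrow> ('v \<Rightarrow> complex) \<Rightarrow> 'v \<Rightarrow> complex" where
  "dual_act \<rho> x f = f \<circ> \<rho> (inv x)"

definition dual_scale :: "complex \<Rightarrow> ('v \<Rightarrow> complex) \<Rightarrow> 'v \<Rightarrow> complex" where
  "dual_scale c f = (\<lambda>v. c * f v)"

text \<open>Averaging V -> V^{S_dd}; (V^{S_dd})^* is identified with (V^*)^{S_dd} via phi |-> phi o avg.\<close>
definition avg :: "((nat \<Rightarrow> nat) \<Rightarrow> complex^'k \<Rightarrow> complex^'k) \<Rightarrow> nat \<Rightarrow> (nat \<Rightarrow> nat) \<Rightarrow> complex^'k \<Rightarrow> complex^'k" where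
  "avg \<rho> d dd v = inverse (of_nat (card (block d dd))) *s (\<Sum>g\<in>block d dd. \<rho> g v)"

end

theory Submission
  imports Defs
begin

text \<open>
  Both sides are computed explicitly. If \<open>w\<close> is the word of a composition \<open>c\<close>, its
  \<open>S_d\<close>-orbit is \<open>S_d/S_c\<close>, so an equivariant tensor supported on that orbit is the
  Schur--Weyl image of \<open>d!/|S_c|\<close> times its value at \<open>w\<close>. The operators \<open>E_a\<close>, \<open>F_a\<close> change
  a single letter, and the words \<open>w\<close>, \<open>w'\<close> of \<open>c\<close> and of \<open>c' = e_a c\<close> (or \<open>f_a c\<close>) differ in
  exactly one position. Evaluated at \<open>u\<close>, both sides of the claimed adjunction become the
  same double sum over pairs \<open>(i, x)\<close> of a position \<open>i\<close> carrying the letter to be changed and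
  a permutation \<open>x\<close> carrying one word to the other with that letter changed; the two sums
  correspond under \<open>(i, x) \<mapsto> (x\<inverse> i, x\<inverse>)\<close>. Counting the same pairs with weight one
  gives \<open>(c_t + 1) |S_c| = c_s |S_c'|\<close>, which is exactly the scalar of the statement.
\<close>

lemma mem_Sd_iff [simp]: "x \<in> Sd d \<longleftrightarrow> x permutes {1..d}"
  by (simp add: Sd_def)

definition transporter :: "nat \<Rightarrow> (nat \<Rightarrow> nat) \<Rightarrow> (nat \<Rightarrow> nat) \<Rightarrow> (nat \<Rightarrow> nat) set" where
  "transporter d w u = {x \<in> Sd d. w \<circ> inv x = u}"

lemma transporter_permutes: "x \<in> transporter d w u \<Longrightarrow> x permutes {1..d}"
  by (simp add: transporter_def)

lemma finite_transporter: "finite (transporter d w u)"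
proof (rule finite_subset)
  show "transporter d w u \<subseteq> {x. x permutes {1..d}}"
    by (auto simp: transporter_def)
qed (simp add: finite_permutations)

lemma transporter_inv:
  assumes "x \<in> transporter d w u"
  shows "inv x \<in> transporter d u w"
proof -
  have x: "x permutes {1..d}" "w \<circ> inv x = u"
    using assms by (auto simp: transporter_def)
  then have "u \<circ> inv (inv x) = w"
    by (auto simp: permutes_inv_inv comp_assoc permutes_inv_o)
  then show ?thesis
    using x by (simp add: transporter_def permutes_inv)
qed

lemma transporter_comp:
  assumes "x \<in> transporter d w v" "y \<in> transporter d v u"
  shows "y \<circ> x \<in> transporter d w u"
proof -
  have x: "x permutes {1..d}" "w \<circ> inv x = v" and y: "y permutes {1..d}" "v \<circ> inv y = u"
    using assms by (auto simp: transporter_def)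
  have "inv (y \<circ> x) = inv x \<circ> inv y"
    using x y by (simp add: o_inv_distrib permutes_bij)
  then have "w \<circ> inv (y \<circ> x) = (w \<circ> inv x) \<circ> inv y"
    by (simp add: comp_assoc)
  then show ?thesis
    using x y by (simp add: transporter_def permutes_compose)
qed

lemma bij_betw_comp_transporter:
  assumes x: "x \<in> transporter d u v"
  shows "bij_betw ((\<circ>) x) (transporter d w u) (transporter d w v)"
proof (rule bij_betw_byWitness[where f' = "(\<circ>) (inv x)"])
  have perm: "x permutes {1..d}"
    using x by (rule transporter_permutes)
  show "\<forall>y\<in>transporter d w u. inv x \<circ> (x \<circ> y) = y"
    by (simp add: comp_assoc[symmetric] permutes_inv_o[OF perm])
  show "\<forall>y\<in>transporter d w v. x \<circ> (inv x \<circ> y) = y"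
    by (simp add: comp_assoc[symmetric] permutes_inv_o[OF perm])
  show "(\<circ>) x ` transporter d w u \<subseteq> transporter d w v"
    using transporter_comp x by blast
  show "(\<circ>) (inv x) ` transporter d w v \<subseteq> transporter d w u"
    using transporter_comp transporter_inv[OF x] by blast
qed

lemma card_transporter:
  assumes "x \<in> transporter d w u"
  shows "card (transporter d w u) = card (transporter d w w)"
  using bij_betw_same_card[OF bij_betw_comp_transporter[OF assms]] by simp

lemma transporter_self: "transporter d w w = {x \<in> Sd d. w \<circ> x = w}"
proof -
  have "w \<circ> inv x = w \<longleftrightarrow> w \<circ> x = w" if "x permutes {1..d}" for x
    using that by (metis comp_assoc comp_id permutes_inv_o)
  then show ?thesis
    by (auto simp: transporter_def)
qed

lemma block_eq_transporter: "block d c = transporter d (wordof d c) (wordof d c)"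
  by (simp add: block_def transporter_self)

lemma id_in_block: "id \<in> block d c"
  by (simp add: block_def)

lemma finite_block: "finite (block d c)"
  by (simp add: block_eq_transporter finite_transporter)

lemma card_block_pos: "0 < card (block d c)"
  using finite_block id_in_block card_gt_0_iff by blast

lemma transporter_upd_swap:
  assumes x: "x \<in> transporter d w (v(i := s))" and i: "i \<in> {1..d}" "v i = t"
  shows "inv x i \<in> {1..d}" "w (inv x i) = s" "inv x \<in> transporter d v (w(inv x i := t))"
proof -
  have perm: "x permutes {1..d}" and wx: "w \<circ> inv x = v(i := s)"
    using x by (auto simp: transporter_def)
  show "inv x i \<in> {1..d}"
    using i permutes_in_image[OF permutes_inv[OF perm]] by simp
  show "w (inv x i) = s"
    using fun_cong[OF wx, of i] by simp
  have "v \<circ> x = w(inv x i := t)"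
  proof
    fix k
    show "(v \<circ> x) k = (w(inv x i := t)) k"
      using fun_cong[OF wx, of "x k"] i
      by (auto simp: permutes_inverses[OF perm] permutes_inv_eq[OF perm])
  qed
  then show "inv x \<in> transporter d v (w(inv x i := t))"
    unfolding transporter_def using permutes_inv[OF perm] permutes_inv_inv[OF perm] by simp
qed

lemma transpose_in_transporter:
  assumes "p \<in> {1..d}" "j \<in> {1..d}" "w p = s" "w j = s"
  shows "Transposition.transpose p j \<in> transporter d (w(p := t)) (w(j := t))"
  using assms by (auto simp: transporter_def permutes_swap_id fun_eq_iff Transposition.transpose_def)

lemma transporter_upd_orbit:
  assumes y: "y \<in> transporter d w (u(i := s))" and i: "i \<in> {1..d}" "u i = t"
    and p: "p \<in> {1..d}" "w p = s"
  shows "y \<circ> Transposition.transpose p (inv y i) \<in> transporter d (w(p := t)) u"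
proof -
  note swap = transporter_upd_swap[OF y i]
  have "Transposition.transpose p (inv y i) \<in> transporter d (w(p := t)) (w(inv y i := t))"
    using transpose_in_transporter p swap(1,2) by blast
  moreover have "y \<in> transporter d (w(inv y i := t)) u"
    using transporter_inv[OF swap(3)] permutes_inv_inv[OF transporter_permutes[OF y]] by simp
  ultimately show ?thesis
    by (rule transporter_comp)
qed

lemma transporter_pair_swap:
  assumes "a \<in> (SIGMA i:{i \<in> {1..d}. v i = t}. transporter d w (v(i := s)))"
  shows "(\<lambda>(i, x). (inv x i, inv x)) a \<in> (SIGMA j:{j \<in> {1..d}. w j = s}. transporter d v (w(j := t)))"
    and "(\<lambda>(i, x). (inv x i, inv x)) ((\<lambda>(i, x). (inv x i, inv x)) a) = a"
proof -
  obtain i x where a: "a = (i, x)" and x: "x \<in> transporter d w (v(i := s))"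
    and i: "i \<in> {1..d}" "v i = t"
    using assms by auto
  have perm: "x permutes {1..d}"
    using x by (rule transporter_permutes)
  show "(\<lambda>(i, x). (inv x i, inv x)) a \<in> (SIGMA j:{j \<in> {1..d}. w j = s}. transporter d v (w(j := t)))"
    using a transporter_upd_swap[OF x i] by simp
  show "(\<lambda>(i, x). (inv x i, inv x)) ((\<lambda>(i, x). (inv x i, inv x)) a) = a"
    using a by (simp add: permutes_inv_inv[OF perm] permutes_inverses[OF perm])
qed

lemma sum_transporter_swap:
  fixes g :: "(nat \<Rightarrow> nat) \<Rightarrow> 'a::comm_monoid_add"
  shows "(\<Sum>i\<in>{i \<in> {1..d}. v i = t}. \<Sum>x\<in>transporter d w (v(i := s)). g (inv x))
       = (\<Sum>j\<in>{j \<in> {1..d}. w j = s}. \<Sum>y\<in>transporter d v (w(j := t)). g y)"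
    (is "?L = ?R")
proof -
  let ?S = "SIGMA i:{i \<in> {1..d}. v i = t}. transporter d w (v(i := s))"
  let ?T = "SIGMA j:{j \<in> {1..d}. w j = s}. transporter d v (w(j := t))"
  let ?swap = "\<lambda>(i, x). (inv x i, inv x)"
  have "?L = (\<Sum>(i, x)\<in>?S. g (inv x))"
    by (rule sum.Sigma) (auto simp: finite_transporter)
  also have "\<dots> = (\<Sum>(j, y)\<in>?T. g y)"
  proof (rule sum.reindex_bij_witness[where i = ?swap and j = ?swap])
    fix a assume "a \<in> ?S"
    then show "?swap (?swap a) = a" "?swap a \<in> ?T"
      by (rule transporter_pair_swap)+
    show "(\<lambda>(j, y). g y) (?swap a) = (\<lambda>(i, x). g (inv x)) a"
      by (simp add: split_beta)
  next
    fix b assume "b \<in> ?T"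
    then show "?swap (?swap b) = b" "?swap b \<in> ?S"
      by (rule transporter_pair_swap)+
  qed
  also have "\<dots> = ?R"
    by (rule sum.Sigma[symmetric]) (auto simp: finite_transporter)
  finally show ?thesis .
qed

lemma card_transporter_self_ratio:
  assumes p: "p \<in> {1..d}" "w p = s" and "s \<noteq> t"
  shows "(card {j \<in> {1..d}. w j = t} + 1) * card (transporter d w w)
       = card {j \<in> {1..d}. w j = s} * card (transporter d (w(p := t)) (w(p := t)))"
proof -
  define v where "v = w(p := t)"
  have w: "w = v(p := s)" and vp: "v p = t"
    using p by (auto simp: v_def)
  have "(\<Sum>i\<in>{i \<in> {1..d}. v i = t}. card (transporter d w (v(i := s))))
      = (\<Sum>i\<in>{i \<in> {1..d}. v i = t}. card (transporter d w w))"
  proof (rule sum.cong)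
    fix i assume "i \<in> {i \<in> {1..d}. v i = t}"
    then have "Transposition.transpose p i \<in> transporter d w (v(i := s))"
      using transpose_in_transporter[where w = v and s = t and t = s, OF p(1) _ vp] w by simp
    then show "card (transporter d w (v(i := s))) = card (transporter d w w)"
      by (rule card_transporter)
  qed simp
  moreover have "{i \<in> {1..d}. v i = t} = insert p {j \<in> {1..d}. w j = t}"
    using p assms(3) by (auto simp: v_def)
  ultimately have lhs: "(\<Sum>i\<in>{i \<in> {1..d}. v i = t}. card (transporter d w (v(i := s))))
      = (card {j \<in> {1..d}. w j = t} + 1) * card (transporter d w w)"
    using p assms(3) by simp
  have "(\<Sum>j\<in>{j \<in> {1..d}. w j = s}. card (transporter d v (w(j := t))))
      = (\<Sum>j\<in>{j \<in> {1..d}. w j = s}. card (transporter d v v))"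
  proof (rule sum.cong)
    fix j assume "j \<in> {j \<in> {1..d}. w j = s}"
    then have "Transposition.transpose p j \<in> transporter d v (w(j := t))"
      using transpose_in_transporter[where w = w and s = s and t = t, OF p(1) _ p(2)] by (simp add: v_def)
    then show "card (transporter d v (w(j := t))) = card (transporter d v v)"
      by (rule card_transporter)
  qed simp
  then have rhs: "(\<Sum>j\<in>{j \<in> {1..d}. w j = s}. card (transporter d v (w(j := t))))
      = card {j \<in> {1..d}. w j = s} * card (transporter d v v)"
    by simp
  show ?thesis
    using sum_transporter_swap[where g = "\<lambda>_. 1 :: nat" and v = v and w = w] lhs rhs
    by (simp add: v_def)
qed

lemma card_block_ratio:
  assumes "wordof d c' = (wordof d c)(p := t)" "p \<in> {1..d}" "wordof d c p = s" "s \<noteq> t"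
  shows "(card {j \<in> {1..d}. wordof d c j = t} + 1) * card (block d c)
       = card {j \<in> {1..d}. wordof d c j = s} * card (block d c')"
  using card_transporter_self_ratio[where w = "wordof d c", OF assms(2-4)] assms(1)
  by (simp add: block_eq_transporter)

definition psum :: "(nat \<Rightarrow> nat) \<Rightarrow> nat \<Rightarrow> nat" where
  "psum c j = (\<Sum>k=1..j. c k)"

lemma psum_0 [simp]: "psum c 0 = 0"
  by (simp add: psum_def)

lemma psum_Suc: "psum c (Suc j) = psum c j + c (Suc j)"
  by (simp add: psum_def)

lemma psum_mono: "j \<le> j' \<Longrightarrow> psum c j \<le> psum c j'"
  unfolding psum_def by (rule sum_mono2) auto

lemma wordof_psum: "wordof d c i = (if i \<in> {1..d} then LEAST j. i \<le> psum c j else 0)"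
  by (simp add: wordof_def psum_def)

lemma wordof_eq_Suc_iff:
  assumes c: "psum c n = d" and i: "i \<in> {1..d}"
  shows "wordof d c i = Suc j \<longleftrightarrow> psum c j < i \<and> i \<le> psum c (Suc j)"
proof
  assume w: "wordof d c i = Suc j"
  have "i \<le> psum c n"
    using c i by simp
  then have "i \<le> psum c (LEAST j. i \<le> psum c j)"
    by (rule LeastI)
  moreover have "\<not> i \<le> psum c j"
    by (rule not_less_Least) (use w i in \<open>simp add: wordof_psum\<close>)
  ultimately show "psum c j < i \<and> i \<le> psum c (Suc j)"
    using w i by (simp add: wordof_psum)
next
  assume between: "psum c j < i \<and> i \<le> psum c (Suc j)"
  have "(LEAST j. i \<le> psum c j) = Suc j"
  proof (rule Least_equality)
    show "i \<le> psum c (Suc j)"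
      using between by simp
    fix y assume "i \<le> psum c y"
    then show "Suc j \<le> y"
      using between psum_mono[of y j c] by (cases "y \<le> j") auto
  qed
  then show "wordof d c i = Suc j"
    using i by (simp add: wordof_psum)
qed

lemma wordof_in_words:
  assumes c: "psum c n = d"
  shows "wordof d c \<in> words n d"
proof -
  have "wordof d c i \<in> {1..n}" if i: "i \<in> {1..d}" for i
  proof -
    have "i \<le> psum c n"
      using c i by simp
    then have "(LEAST j. i \<le> psum c j) \<le> n"
      by (rule Least_le)
    moreover have "(LEAST j. i \<le> psum c j) \<noteq> 0"
    proof
      assume "(LEAST j. i \<le> psum c j) = 0"
      then show False
        using LeastI[of "\<lambda>j. i \<le> psum c j", OF \<open>i \<le> psum c n\<close>] i by simp
    qed
    ultimately show ?thesis
      using i by (simp add: wordof_psum)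
  qed
  then show ?thesis
    by (simp add: words_def wordof_psum)
qed

lemma card_wordof_eq:
  assumes c: "psum c n = d" and j: "1 \<le> j" "j \<le> n"
  shows "card {i \<in> {1..d}. wordof d c i = j} = c j"
proof -
  obtain j' where j': "j = Suc j'"
    using j(1) by (cases j) auto
  have "psum c j \<le> d"
    using psum_mono[OF j(2), of c] c by simp
  then have "{i \<in> {1..d}. wordof d c i = j} = {Suc (psum c j')..psum c j}"
    using wordof_eq_Suc_iff[OF c] j' by auto
  then show ?thesis
    by (simp add: j' psum_Suc)
qed

lemma wordof_Suc_psum:
  assumes c: "psum c n = d" and j: "Suc j \<le> n" "1 \<le> c (Suc j)"
  shows "Suc (psum c j) \<in> {1..d}" "wordof d c (Suc (psum c j)) = Suc j"
proof -
  have "psum c (Suc j) \<le> d"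
    using psum_mono[OF j(1), of c] c by simp
  then show p: "Suc (psum c j) \<in> {1..d}"
    using j(2) by (simp add: psum_Suc)
  show "wordof d c (Suc (psum c j)) = Suc j"
    using j(2) by (simp add: wordof_eq_Suc_iff[OF c p] psum_Suc)
qed

lemma psum_e_comp:
  assumes "1 \<le> a" "1 \<le> c (Suc a)"
  shows "psum (e_comp a c) j = (if j = a then Suc (psum c a) else psum c j)"
proof (induction j)
  case 0
  then show ?case
    using assms by simp
next
  case (Suc j)
  then show ?case
    using assms by (auto simp: psum_Suc e_comp_def)
qed

lemma wordof_e_comp:
  assumes c: "psum c n = d" and a: "1 \<le> a" "a < n" and pos: "1 \<le> c (Suc a)"
  shows "wordof d (e_comp a c) = (wordof d c)(Suc (psum c a) := a)"
proof
  fix i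
  let ?p = "Suc (psum c a)"
  have ps: "psum (e_comp a c) j = (if j = a then ?p else psum c j)" for j
    using psum_e_comp[of a c, OF a(1) pos] .
  show "wordof d (e_comp a c) i = ((wordof d c)(?p := a)) i"
  proof (cases "i = ?p")
    case True
    have p: "?p \<in> {1..d}"
      using wordof_Suc_psum[OF c _ pos] a(2) by simp
    have "(LEAST j. ?p \<le> psum (e_comp a c) j) = a"
    proof (rule Least_equality)
      show "?p \<le> psum (e_comp a c) a"
        by (simp add: ps)
      fix y assume "?p \<le> psum (e_comp a c) y"
      then show "a \<le> y"
        using psum_mono[of y a c] by (cases "a \<le> y") (auto simp: ps split: if_splits)
    qed
    then show ?thesis
      using True p by (simp add: wordof_psum)
  next
    case False
    then have "(\<lambda>j. i \<le> psum (e_comp a c) j) = (\<lambda>j. i \<le> psum c j)"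
      by (auto simp: ps fun_eq_iff)
    then show ?thesis
      using False by (simp add: wordof_psum)
  qed
qed

lemma f_comp_e_comp: "1 \<le> c (Suc a) \<Longrightarrow> f_comp a (e_comp a c) = c"
  by (auto simp: e_comp_def f_comp_def fun_eq_iff)

lemma e_comp_f_comp: "1 \<le> c a \<Longrightarrow> e_comp a (f_comp a c) = c"
  by (auto simp: e_comp_def f_comp_def fun_eq_iff)

lemma psum_f_comp:
  assumes "1 \<le> a" "1 \<le> c a"
  shows "psum (f_comp a c) j = (if j = a then psum c a - 1 else psum c j)"
proof -
  have "1 \<le> f_comp a c (Suc a)"
    by (simp add: f_comp_def)
  from psum_e_comp[of a "f_comp a c", OF assms(1) this]
  show ?thesis
    by (simp add: e_comp_f_comp[of c a, OF assms(2)])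
qed

lemma wordof_f_comp:
  assumes c: "psum c n = d" and a: "1 \<le> a" "a < n" and pos: "1 \<le> c a"
  shows "psum c a \<in> {1..d}" "wordof d c (psum c a) = a"
    and "wordof d (f_comp a c) = (wordof d c)(psum c a := Suc a)"
proof -
  let ?c = "f_comp a c"
  have pos': "1 \<le> ?c (Suc a)"
    by (simp add: f_comp_def)
  have c': "psum ?c n = d"
    using psum_f_comp[of a c n, OF a(1) pos] c a(2) by simp
  have pa: "psum c a = Suc (psum ?c a)"
    using psum_e_comp[of a ?c a, OF a(1) pos'] by (simp add: e_comp_f_comp[of c a, OF pos])
  have word: "wordof d c = (wordof d ?c)(psum c a := a)"
    using wordof_e_comp[OF c' a pos'] pa by (simp add: e_comp_f_comp[of c a, OF pos])
  show "psum c a \<in> {1..d}"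
    using wordof_Suc_psum(1)[of ?c n d a, OF c' _ pos'] a(2) pa by simp
  show "wordof d c (psum c a) = a"
    using word by simp
  have "wordof d ?c (psum c a) = Suc a"
    using wordof_Suc_psum(2)[of ?c n d a, OF c' _ pos'] a(2) pa by simp
  then show "wordof d ?c = (wordof d c)(psum c a := Suc a)"
    using word by (simp add: fun_eq_iff)
qed

text \<open>The action of \<open>\<theta>_s \<mapsto> \<theta>_t\<close> on \<open>M \<otimes> E\<^sup>\<otimes>\<^sup>d\<close>, so that \<open>E_a\<close> and \<open>F_a\<close> are the cases
  \<open>(t, s) = (a, a + 1)\<close> and \<open>(a + 1, a)\<close>.\<close>

definition tens_shift :: "nat \<Rightarrow> nat \<Rightarrow> nat \<Rightarrow> ((nat \<Rightarrow> nat) \<Rightarrow> 'm) \<Rightarrow> (nat \<Rightarrow> nat) \<Rightarrow> 'm::comm_monoid_add"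
  where "tens_shift d t s T u = (\<Sum>i\<in>{i \<in> {1..d}. u i = t}. T (u(i := s)))"

definition SW_shift :: "(complex \<Rightarrow> 'm \<Rightarrow> 'm) \<Rightarrow> ((nat \<Rightarrow> nat) \<Rightarrow> 'm \<Rightarrow> 'm) \<Rightarrow> nat \<Rightarrow> nat
    \<Rightarrow> nat \<Rightarrow> nat \<Rightarrow> (nat \<Rightarrow> nat) \<Rightarrow> (nat \<Rightarrow> nat) \<Rightarrow> 'm \<Rightarrow> 'm::comm_monoid_add" where
  "SW_shift sc \<rho> n d t s c c' m = (THE m'. m' \<in> invariants \<rho> (block d c') \<and>
     (\<forall>u\<in>words n d. SW_embed sc \<rho> d c' m' u = tens_shift d t s (SW_embed sc \<rho> d c m) u))"

lemma SW_E_eq_SW_shift: "SW_E sc \<rho> n d a c m = SW_shift sc \<rho> n d a (Suc a) c (e_comp a c) m"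
  unfolding SW_E_def SW_shift_def tensE_def tens_shift_def ..

lemma SW_F_eq_SW_shift: "SW_F sc \<rho> n d a c m = SW_shift sc \<rho> n d (Suc a) a c (f_comp a c) m"
  unfolding SW_F_def SW_shift_def tensF_def tens_shift_def ..

lemma SW_embed_transporter:
  "SW_embed sc \<rho> d c m u = sc (inverse (fact d)) (\<Sum>x\<in>transporter d (wordof d c) u. \<rho> x m)"
  by (simp add: SW_embed_def transporter_def)

locale Sd_module = vector_space sc
  for sc :: "complex \<Rightarrow> 'm::ab_group_add \<Rightarrow> 'm" +
  fixes \<rho> :: "(nat \<Rightarrow> nat) \<Rightarrow> 'm \<Rightarrow> 'm" and d :: nat
  assumes linear_action: "x \<in> Sd d \<Longrightarrow> Vector_Spaces.linear sc sc (\<rho> x)"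
    and action_comp: "x \<in> Sd d \<Longrightarrow> y \<in> Sd d \<Longrightarrow> \<rho> (x \<circ> y) = \<rho> x \<circ> \<rho> y"
begin

lemma action_sum: "x \<in> Sd d \<Longrightarrow> \<rho> x (sum f A) = (\<Sum>a\<in>A. \<rho> x (f a))"
  using module_hom.sum[OF module_hom_linearI[OF linear_action]] .

lemma action_add: "x \<in> Sd d \<Longrightarrow> \<rho> x (m + m') = \<rho> x m + \<rho> x m'"
  using module_hom.add[OF module_hom_linearI[OF linear_action]] .

lemma action_scale: "x \<in> Sd d \<Longrightarrow> \<rho> x (sc a m) = sc a (\<rho> x m)"
  using module_hom.scale[OF module_hom_linearI[OF linear_action]] .

lemma invariants_scale: "v \<in> invariants \<rho> (block d c) \<Longrightarrow> sc a v \<in> invariants \<rho> (block d c)"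
  by (simp add: invariants_def block_def action_scale)

lemma SW_embed_equivariant:
  assumes x: "x \<in> Sd d"
  shows "SW_embed sc \<rho> d c m (u \<circ> inv x) = \<rho> x (SW_embed sc \<rho> d c m u)"
proof -
  have "x \<in> transporter d u (u \<circ> inv x)"
    using x by (simp add: transporter_def)
  then have "(\<Sum>z\<in>transporter d (wordof d c) (u \<circ> inv x). \<rho> z m)
      = (\<Sum>y\<in>transporter d (wordof d c) u. \<rho> (x \<circ> y) m)"
    by (rule sum.reindex_bij_betw[OF bij_betw_comp_transporter, symmetric])
  also have "\<dots> = \<rho> x (\<Sum>y\<in>transporter d (wordof d c) u. \<rho> y m)"
    using x by (simp add: action_sum action_comp transporter_def)
  finally show ?thesis
    using x by (simp add: SW_embed_transporter action_scale)
qed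

lemma tens_shift_equivariant:
  assumes x: "x \<in> Sd d" and T: "\<And>v. T (v \<circ> inv x) = \<rho> x (T v)"
  shows "tens_shift d t s T (u \<circ> inv x) = \<rho> x (tens_shift d t s T u)"
proof -
  have perm: "x permutes {1..d}"
    using x by simp
  have "tens_shift d t s T (u \<circ> inv x) = (\<Sum>j\<in>{j \<in> {1..d}. u j = t}. T ((u \<circ> inv x)(x j := s)))"
    unfolding tens_shift_def
    by (rule sum.reindex_bij_witness[where i = x and j = "inv x"])
      (use permutes_inverses[OF perm] permutes_in_image[OF perm]
        permutes_in_image[OF permutes_inv[OF perm]] in auto)
  also have "\<dots> = (\<Sum>j\<in>{j \<in> {1..d}. u j = t}. \<rho> x (T (u(j := s))))"
  proof (rule sum.cong)
    fix j
    have "(u \<circ> inv x)(x j := s) = u(j := s) \<circ> inv x"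
      by (auto simp: fun_eq_iff permutes_inverses[OF perm] permutes_inv_eq[OF perm])
    then show "T ((u \<circ> inv x)(x j := s)) = \<rho> x (T (u(j := s)))"
      by (simp add: T)
  qed simp
  finally show ?thesis
    using x by (simp add: tens_shift_def action_sum)
qed

lemma tens_shift_SW_embed_equivariant:
  assumes "x \<in> Sd d"
  shows "tens_shift d t s (SW_embed sc \<rho> d c m) (u \<circ> inv x)
    = \<rho> x (tens_shift d t s (SW_embed sc \<rho> d c m) u)"
  using assms SW_embed_equivariant[OF assms] by (rule tens_shift_equivariant)

lemma SW_embed_wordof:
  assumes "m \<in> invariants \<rho> (block d c)"
  shows "SW_embed sc \<rho> d c m (wordof d c) = sc (of_nat (card (block d c)) / fact d) m"
proof -
  have "(\<Sum>x\<in>block d c. \<rho> x m) = (\<Sum>x\<in>block d c. m)"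
    using assms by (simp add: invariants_def)
  also have "\<dots> = sc (of_nat (card (block d c))) m"
    using scale_sum_left[of "\<lambda>_. 1" "block d c" m] by simp
  finally show ?thesis
    by (simp add: SW_embed_transporter block_eq_transporter[symmetric] divide_inverse mult.commute)
qed

lemma tens_shift_wordof_invariant:
  "tens_shift d t s (SW_embed sc \<rho> d c m) (wordof d c') \<in> invariants \<rho> (block d c')"
  unfolding invariants_def
proof (intro CollectI ballI)
  fix x assume "x \<in> block d c'"
  then have x: "x \<in> Sd d" "wordof d c' \<circ> inv x = wordof d c'"
    by (auto simp: block_eq_transporter transporter_def)
  then show "\<rho> x (tens_shift d t s (SW_embed sc \<rho> d c m) (wordof d c'))
      = tens_shift d t s (SW_embed sc \<rho> d c m) (wordof d c')"
    using tens_shift_SW_embed_equivariant[OF x(1), of t s c m "wordof d c'"] by simp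
qed

text \<open>Both sides are equivariant in \<open>u\<close> and vanish off the orbit of the word of \<open>c'\<close>
  (by \<open>transporter_upd_orbit\<close>), so it suffices to compare them at that word.\<close>

lemma SW_embed_tens_shift:
  assumes w': "wordof d c' = (wordof d c)(p := t)" and p: "p \<in> {1..d}" "wordof d c p = s"
  shows "SW_embed sc \<rho> d c'
      (sc (fact d / of_nat (card (block d c'))) (tens_shift d t s (SW_embed sc \<rho> d c m) (wordof d c'))) u
    = tens_shift d t s (SW_embed sc \<rho> d c m) u"
  (is "SW_embed sc \<rho> d c' ?m0 u = ?T u")
proof (cases "transporter d (wordof d c') u = {}")
  case True
  have "transporter d (wordof d c) (u(i := s)) = {}" if i: "i \<in> {1..d}" "u i = t" for i
  proof (rule equals0I)
    fix y assume "y \<in> transporter d (wordof d c) (u(i := s))"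
    from transporter_upd_orbit[where w = "wordof d c" and u = u, OF this i p] show False
      using True w' by simp
  qed
  then have "?T u = 0"
    by (simp add: tens_shift_def SW_embed_transporter)
  moreover have "SW_embed sc \<rho> d c' ?m0 u = 0"
    using True by (simp add: SW_embed_transporter)
  ultimately show ?thesis
    by simp
next
  case False
  then obtain x where x: "x \<in> transporter d (wordof d c') u"
    by blast
  then have x': "x \<in> Sd d" and u: "u = wordof d c' \<circ> inv x"
    by (auto simp: transporter_def)
  have "SW_embed sc \<rho> d c' ?m0 (wordof d c') = ?T (wordof d c')"
    using SW_embed_wordof[OF invariants_scale[OF tens_shift_wordof_invariant]] card_block_pos[of d c']
    by simp
  then show ?thesis
    unfolding u SW_embed_equivariant[OF x'] tens_shift_SW_embed_equivariant[OF x'] by simp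
qed

lemma SW_shift_eq:
  assumes w': "wordof d c' = (wordof d c)(p := t)" and p: "p \<in> {1..d}" "wordof d c p = s"
    and words: "wordof d c' \<in> words n d"
  shows "SW_shift sc \<rho> n d t s c c' m
    = sc (fact d / of_nat (card (block d c'))) (tens_shift d t s (SW_embed sc \<rho> d c m) (wordof d c'))"
  (is "_ = ?m0")
  unfolding SW_shift_def
proof (rule the_equality)
  show "?m0 \<in> invariants \<rho> (block d c')
    \<and> (\<forall>u\<in>words n d. SW_embed sc \<rho> d c' ?m0 u = tens_shift d t s (SW_embed sc \<rho> d c m) u)"
    using invariants_scale[OF tens_shift_wordof_invariant] SW_embed_tens_shift[OF w' p] by blast
next
  fix m' assume m': "m' \<in> invariants \<rho> (block d c')
    \<and> (\<forall>u\<in>words n d. SW_embed sc \<rho> d c' m' u = tens_shift d t s (SW_embed sc \<rho> d c m) u)"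
  then have "tens_shift d t s (SW_embed sc \<rho> d c m) (wordof d c')
      = sc (of_nat (card (block d c')) / fact d) m'"
    using SW_embed_wordof[of m' c'] words by simp
  then have "?m0 = sc (fact d / of_nat (card (block d c')) * (of_nat (card (block d c')) / fact d)) m'"
    by simp
  also have "\<dots> = m'"
    using card_block_pos[of d c'] by simp
  finally show "m' = ?m0" ..
qed

lemma SW_shift_invariant:
  assumes "wordof d c' = (wordof d c)(p := t)" "p \<in> {1..d}" "wordof d c p = s"
    and "wordof d c' \<in> words n d"
  shows "SW_shift sc \<rho> n d t s c c' m \<in> invariants \<rho> (block d c')"
  unfolding SW_shift_eq[OF assms] by (rule invariants_scale[OF tens_shift_wordof_invariant])


lemma SW_shift_functional:
  assumes w': "wordof d c' = (wordof d c)(p := t)" and p: "p \<in> {1..d}" "wordof d c p = s"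
    and words: "wordof d c' \<in> words n d" and \<psi>: "module_hom sc (*) \<psi>"
  shows "\<psi> (SW_shift sc \<rho> n d t s c c' m)
    = (\<Sum>i\<in>{i \<in> {1..d}. wordof d c' i = t}.
        \<Sum>x\<in>transporter d (wordof d c) ((wordof d c')(i := s)). \<psi> (\<rho> x m))
      / of_nat (card (block d c'))"
proof -
  interpret \<psi>: module_hom sc "(*)" \<psi> by (rule \<psi>)
  show ?thesis
    by (simp add: SW_shift_eq[OF w' p words] \<psi>.scale \<psi>.sum tens_shift_def SW_embed_transporter
        sum_distrib_left[symmetric])
qed

end

lemma Sd_module_vec:
  fixes \<rho> :: "(nat \<Rightarrow> nat) \<Rightarrow> complex^'k \<Rightarrow> complex^'k"
  assumes "\<forall>x\<in>Sd d. Vector_Spaces.linear (*s) (*s) (\<rho> x)"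
    and "\<forall>x\<in>Sd d. \<forall>y\<in>Sd d. \<rho> (x \<circ> y) = \<rho> x \<circ> \<rho> y"
  shows "Sd_module (*s) \<rho> d"
  using assms by (intro Sd_module.intro Sd_module_axioms.intro vec.vector_space_axioms) auto

lemma vector_space_dual_scale: "vector_space (dual_scale :: complex \<Rightarrow> ('v \<Rightarrow> complex) \<Rightarrow> _)"
  by unfold_locales (auto simp: dual_scale_def fun_eq_iff algebra_simps)

lemma Sd_module_dual:
  fixes \<rho> :: "(nat \<Rightarrow> nat) \<Rightarrow> 'v \<Rightarrow> 'v"
  assumes comp: "\<forall>x\<in>Sd d. \<forall>y\<in>Sd d. \<rho> (x \<circ> y) = \<rho> x \<circ> \<rho> y"
  shows "Sd_module dual_scale (dual_act \<rho>) d"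
proof (intro Sd_module.intro Sd_module_axioms.intro)
  show "vector_space (dual_scale :: complex \<Rightarrow> ('v \<Rightarrow> complex) \<Rightarrow> _)"
    by (rule vector_space_dual_scale)
  show "Vector_Spaces.linear dual_scale dual_scale (dual_act \<rho> x)" for x
    using vector_space_dual_scale by (auto simp: linear_iff_module_hom module_hom_iff module_iff_vector_space
        dual_scale_def dual_act_def)
  fix x y :: "nat \<Rightarrow> nat"
  assume x: "x \<in> Sd d" and y: "y \<in> Sd d"
  then have "inv (x \<circ> y) = inv y \<circ> inv x"
    by (simp add: o_inv_distrib permutes_bij)
  moreover have "inv y \<in> Sd d" "inv x \<in> Sd d"
    using x y by (simp_all add: permutes_inv)
  ultimately have "\<rho> (inv (x \<circ> y)) = \<rho> (inv y) \<circ> \<rho> (inv x)"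
    using comp by simp
  then show "dual_act \<rho> (x \<circ> y) = dual_act \<rho> x \<circ> dual_act \<rho> y"
    by (simp add: dual_act_def fun_eq_iff)
qed

lemma avg_invariant:
  assumes "Sd_module (*s) \<rho> d"
  shows "avg \<rho> d c v \<in> invariants \<rho> (block d c)"
  unfolding invariants_def
proof (intro CollectI ballI)
  interpret Sd_module "(*s)" \<rho> d by fact
  fix h assume h: "h \<in> block d c"
  then have h': "h \<in> Sd d"
    by (simp add: block_def)
  have "bij_betw ((\<circ>) h) (block d c) (block d c)"
    using bij_betw_comp_transporter[of h d "wordof d c" "wordof d c" "wordof d c"] h
    by (simp add: block_eq_transporter)
  then have "(\<Sum>g\<in>block d c. \<rho> (h \<circ> g) v) = (\<Sum>g\<in>block d c. \<rho> g v)"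
    by (rule sum.reindex_bij_betw)
  then show "\<rho> h (avg \<rho> d c v) = avg \<rho> d c v"
    using h' by (simp add: avg_def action_scale action_sum action_comp block_def)
qed

lemma avg_fixes_invariants:
  assumes "v \<in> invariants \<rho> (block d c)"
  shows "avg \<rho> d c v = v"
proof -
  have "(\<Sum>g\<in>block d c. \<rho> g v) = (\<Sum>g\<in>block d c. v)"
    using assms by (simp add: invariants_def)
  also have "\<dots> = of_nat (card (block d c)) *s v"
    using vec.scale_sum_left[of "\<lambda>_. 1" "block d c" v] by simp
  finally have "(\<Sum>g\<in>block d c. \<rho> g v) = of_nat (card (block d c)) *s v" .
  then show ?thesis
    using card_block_pos[of d c] by (simp add: avg_def vector_smult_assoc)
qed

lemma module_hom_comp_avg:
  assumes "Sd_module (*s) \<rho> d"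
    and "\<forall>v\<in>invariants \<rho> (block d c). \<forall>w\<in>invariants \<rho> (block d c). \<phi> (v + w) = \<phi> v + \<phi> w"
    and "\<forall>a. \<forall>v\<in>invariants \<rho> (block d c). \<phi> (a *s v) = a * \<phi> v"
  shows "module_hom (*s) (*) (\<phi> \<circ> avg \<rho> d c)"
proof -
  interpret Sd_module "(*s)" \<rho> d by fact
  have "avg \<rho> d c (v + w) = avg \<rho> d c v + avg \<rho> d c w" for v w
    by (simp add: avg_def action_add sum.distrib vector_add_ldistrib block_def)
  moreover have "avg \<rho> d c (a *s v) = a *s avg \<rho> d c v" for a v
    by (simp add: avg_def action_scale vec.scale_sum_right[symmetric] block_def mult.commute)
  ultimately show ?thesis
    using assms(2,3) avg_invariant[OF assms(1)]
    by (simp add: module_hom_iff vec.module_axioms vector_space_over_itself.module_axioms)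
qed

lemma module_hom_eval: "module_hom dual_scale (*) (\<lambda>f :: 'v \<Rightarrow> complex. f v)"
  using vector_space_dual_scale
  by (auto simp: module_hom_iff module_iff_vector_space dual_scale_def
      vector_space_over_itself.vector_space_axioms)

lemma SW_shift_dual_adjoint:
  fixes \<rho> :: "(nat \<Rightarrow> nat) \<Rightarrow> complex^'k \<Rightarrow> complex^'k" and \<phi> :: "complex^'k \<Rightarrow> complex"
  assumes V: "Sd_module (*s) \<rho> d"
    and w': "wordof d c' = (wordof d c)(p := t)" and p: "p \<in> {1..d}" "wordof d c p = s"
    and st: "s \<noteq> t"
    and words: "wordof d c \<in> words n d" "wordof d c' \<in> words n d"
    and \<phi>_add: "\<forall>v\<in>invariants \<rho> (block d c). \<forall>w\<in>invariants \<rho> (block d c). \<phi> (v + w) = \<phi> v + \<phi> w"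
    and \<phi>_scale: "\<forall>a. \<forall>v\<in>invariants \<rho> (block d c). \<phi> (a *s v) = a * \<phi> v"
  shows "SW_shift dual_scale (dual_act \<rho>) n d t s c c' (\<phi> \<circ> avg \<rho> d c) u
    = \<phi> ((of_nat (card {j \<in> {1..d}. wordof d c j = s}) / of_nat (card {j \<in> {1..d}. wordof d c j = t} + 1))
          *s SW_shift (*s) \<rho> n d s t c' c u)"
proof -
  interpret V: Sd_module "(*s)" \<rho> d by (rule V)
  interpret D: Sd_module dual_scale "dual_act \<rho>" d
    by (rule Sd_module_dual) (simp add: V.action_comp)
  define \<psi> where "\<psi> = \<phi> \<circ> avg \<rho> d c"
  define X where "X = SW_shift (*s) \<rho> n d s t c' c u"
  define Q where "Q = (\<Sum>j\<in>{j \<in> {1..d}. wordof d c j = s}.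
      \<Sum>y\<in>transporter d (wordof d c') ((wordof d c)(j := t)). \<psi> (\<rho> y u))"
  define K where "K = (of_nat (card (block d c)) :: complex)"
  define K' where "K' = (of_nat (card (block d c')) :: complex)"
  define Ks where "Ks = (of_nat (card {j \<in> {1..d}. wordof d c j = s}) :: complex)"
  define Kt where "Kt = (of_nat (card {j \<in> {1..d}. wordof d c j = t}) :: complex)"
  have w: "wordof d c = (wordof d c')(p := s)" and w'p: "wordof d c' p = t"
    using w' p by auto
  have lhs: "SW_shift dual_scale (dual_act \<rho>) n d t s c c' \<psi> u = Q / K'"
    using D.SW_shift_functional[OF w' p words(2) module_hom_eval, of \<psi> u]
    unfolding dual_act_def o_apply sum_transporter_swap[where g = "\<lambda>y. \<psi> (\<rho> y u)"]
    by (simp add: Q_def K'_def)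
  have rhs: "\<psi> X = Q / K"
    using V.SW_shift_functional[OF w p(1) w'p words(1) module_hom_comp_avg[OF V \<phi>_add \<phi>_scale]]
    by (simp add: X_def Q_def K_def \<psi>_def)
  have "X \<in> invariants \<rho> (block d c)"
    unfolding X_def by (rule V.SW_shift_invariant[OF w p(1) w'p words(1)])
  then have scale_X: "\<phi> (a *s X) = a * \<psi> X" for a
    using \<phi>_scale by (simp add: \<psi>_def avg_fixes_invariants)
  have "of_nat ((card {j \<in> {1..d}. wordof d c j = t} + 1) * card (block d c))
      = (of_nat (card {j \<in> {1..d}. wordof d c j = s} * card (block d c')) :: complex)"
    using card_block_ratio[OF w' p st] by (rule arg_cong)
  then have ratio: "Ks * K' = (Kt + 1) * K"
    unfolding Ks_def Kt_def K_def K'_def by (simp add: algebra_simps)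
  moreover have "K \<noteq> 0"
    using card_block_pos[of d c] by (simp add: K_def)
  ultimately have "Ks \<noteq> 0"
    using of_nat_neq_0[of "card {j \<in> {1..d}. wordof d c j = t}"] by (auto simp: Kt_def add.commute)
  have "SW_shift dual_scale (dual_act \<rho>) n d t s c c' (\<phi> \<circ> avg \<rho> d c) u = (Ks * Q) / (Ks * K')"
    using lhs \<open>Ks \<noteq> 0\<close> by (simp add: \<psi>_def)
  also have "\<dots> = Ks / (Kt + 1) * \<psi> X"
    by (simp add: ratio rhs)
  also have "\<dots> = \<phi> ((of_nat (card {j \<in> {1..d}. wordof d c j = s})
      / of_nat (card {j \<in> {1..d}. wordof d c j = t} + 1)) *s X)"
    by (simp add: scale_X Ks_def Kt_def)
  finally show ?thesis
    unfolding X_def .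
qed

lemma SW_E_dual_adjoint:
  fixes \<rho> :: "(nat \<Rightarrow> nat) \<Rightarrow> complex^'k \<Rightarrow> complex^'k" and \<phi> :: "complex^'k \<Rightarrow> complex"
  assumes V: "Sd_module (*s) \<rho> d" and dd: "psum dd n = d" and a: "1 \<le> a" "a < n"
    and pos: "1 \<le> dd (Suc a)"
    and add: "\<forall>v\<in>invariants \<rho> (block d dd). \<forall>w\<in>invariants \<rho> (block d dd). \<phi> (v + w) = \<phi> v + \<phi> w"
    and scale: "\<forall>c. \<forall>v\<in>invariants \<rho> (block d dd). \<phi> (c *s v) = c * \<phi> v"
  shows "SW_E dual_scale (dual_act \<rho>) n d a dd (\<phi> \<circ> avg \<rho> d dd) u
    = \<phi> ((of_nat (dd (Suc a)) / of_nat (dd a + 1)) *s SW_F (*s) \<rho> n d a (e_comp a dd) u)"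
proof -
  have "psum (e_comp a dd) n = d"
    using psum_e_comp[of a dd n] a pos dd by simp
  from SW_shift_dual_adjoint[OF V wordof_e_comp[OF dd a pos] wordof_Suc_psum[of dd n d a, OF dd _ pos]
      _ wordof_in_words[OF dd] wordof_in_words[OF this] add scale]
  show ?thesis
    using a card_wordof_eq[OF dd, of a] card_wordof_eq[OF dd, of "Suc a"]
    by (simp add: SW_E_eq_SW_shift SW_F_eq_SW_shift f_comp_e_comp[of dd a, OF pos])
qed

lemma SW_F_dual_adjoint:
  fixes \<rho> :: "(nat \<Rightarrow> nat) \<Rightarrow> complex^'k \<Rightarrow> complex^'k" and \<phi> :: "complex^'k \<Rightarrow> complex"
  assumes V: "Sd_module (*s) \<rho> d" and dd: "psum dd n = d" and a: "1 \<le> a" "a < n"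
    and pos: "1 \<le> dd a"
    and add: "\<forall>v\<in>invariants \<rho> (block d dd). \<forall>w\<in>invariants \<rho> (block d dd). \<phi> (v + w) = \<phi> v + \<phi> w"
    and scale: "\<forall>c. \<forall>v\<in>invariants \<rho> (block d dd). \<phi> (c *s v) = c * \<phi> v"
  shows "SW_F dual_scale (dual_act \<rho>) n d a dd (\<phi> \<circ> avg \<rho> d dd) u
    = \<phi> ((of_nat (dd a) / of_nat (dd (Suc a) + 1)) *s SW_E (*s) \<rho> n d a (f_comp a dd) u)"
proof -
  have "psum (f_comp a dd) n = d"
    using psum_f_comp[of a dd n] a pos dd by simp
  from SW_shift_dual_adjoint[OF V wordof_f_comp(3,1,2)[OF dd a pos]
      _ wordof_in_words[OF dd] wordof_in_words[OF this] add scale]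
  show ?thesis
    using a card_wordof_eq[OF dd, of a] card_wordof_eq[OF dd, of "Suc a"]
    by (simp add: SW_E_eq_SW_shift SW_F_eq_SW_shift e_comp_f_comp[of dd a, OF pos])
qed

theorem mainTheorem4:
  fixes \<rho> :: "(nat \<Rightarrow> nat) \<Rightarrow> complex^'k \<Rightarrow> complex^'k"
    and n d a :: nat and dd :: "nat \<Rightarrow> nat"
  assumes "n \<ge> 1" and "d \<ge> 1"
    and lin: "\<forall>x\<in>Sd d. Vector_Spaces.linear (*s) (*s) (\<rho> x)"
    and rep_id: "\<rho> id = id"
    and rep_mult: "\<forall>x\<in>Sd d. \<forall>y\<in>Sd d. \<rho> (x \<circ> y) = \<rho> x \<circ> \<rho> y"
    and comp_sum: "(\<Sum>i=1..n. dd i) = d"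
    and dominant: "\<forall>i j. 1 \<le> i \<longrightarrow> i \<le> j \<longrightarrow> j \<le> n \<longrightarrow> dd j \<le> dd i"
    and a: "1 \<le> a" "a < n"
  shows "(dd (Suc a) \<ge> 1 \<longrightarrow>
      (\<forall>\<phi> :: complex^'k \<Rightarrow> complex.
         (\<forall>v\<in>invariants \<rho> (block d dd). \<forall>w\<in>invariants \<rho> (block d dd). \<phi> (v + w) = \<phi> v + \<phi> w) \<longrightarrow>
         (\<forall>c. \<forall>v\<in>invariants \<rho> (block d dd). \<phi> (c *s v) = c * \<phi> v) \<longrightarrow>
         (\<forall>u\<in>invariants \<rho> (block d (e_comp a dd)).
            SW_E dual_scale (dual_act \<rho>) n d a dd (\<phi> \<circ> avg \<rho> d dd) u
            = \<phi> ((of_nat (dd (Suc a)) / of_nat (dd a + 1)) *s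
                   SW_F (*s) \<rho> n d a (e_comp a dd) u))))
    \<and> (dd a \<ge> 1 \<longrightarrow>
      (\<forall>\<phi> :: complex^'k \<Rightarrow> complex.
         (\<forall>v\<in>invariants \<rho> (block d dd). \<forall>w\<in>invariants \<rho> (block d dd). \<phi> (v + w) = \<phi> v + \<phi> w) \<longrightarrow>
         (\<forall>c. \<forall>v\<in>invariants \<rho> (block d dd). \<phi> (c *s v) = c * \<phi> v) \<longrightarrow>
         (\<forall>u\<in>invariants \<rho> (block d (f_comp a dd)).
            SW_F dual_scale (dual_act \<rho>) n d a dd (\<phi> \<circ> avg \<rho> d dd) u
            = \<phi> ((of_nat (dd a) / of_nat (dd (Suc a) + 1)) *s
                   SW_E (*s) \<rho> n d a (f_comp a dd) u))))"
proof -
  have V: "Sd_module (*s) \<rho> d"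
    using lin rep_mult by (rule Sd_module_vec)
  have dd: "psum dd n = d"
    using comp_sum by (simp add: psum_def)
  show ?thesis
    using SW_E_dual_adjoint[OF V dd a] SW_F_dual_adjoint[OF V dd a] by blast
qed

end
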